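(* Let $L$ be a virtual link diagram, let $s$ be a state of $L$, and let $G_L^s$ be the associated signed arrow ribbon graph, having $e_+$ positive and $e_-$ negative edges. Then $$\langle L\rangle_A(A,B,d)=\frac{A^{e_+}B^{e_-}}{d}\,A_{G_L^s}(1,\mathbf{b},d,\mathbf{K}),$$ where the edge weights are specialized to $b_e=B/A$ if $e$ is positive and $b_e=A/B$ if $e$ is negative.
   Context: A virtual link diagram is a planar diagram of an oriented link in which some crossings are classical (with over/under information) and others are designated virtual. At a classical crossing, the $A$-splitting joins the two vertical angles swept out by the overcrossing arc when rotated counterclockwise toward the undercrossing arc, and the $B$-splitting joins the other two angles. A state $s$ is a choice of $A$- or $B$-splitting at each classical crossing; the result is a collection of closed curves (state circles), virtual crossings not connecting components. When the splitting at a crossing does not respect the orientation of the strands, two arrows are placed on the two branches of the splitting near the crossing, oriented counterclockwise; this equips the state circles with arrows. For a circle $c$ carrying arrows, $K_c:=K_{i}$ where $i$ is half the number of arrows remaining on $c$ after recursively cancelling all neighbouring pairs of arrows pointing in the same direction along $c$; $K_0:=1$ and $K_{1/2},K_1,K_2,\dots$ are independent variables. The arrow bracket polynomial is $$\langle L\rangle_A(A,B,d):=\sum_{s}A^{\alpha(s)}B^{\beta(s)}d^{\delta(s)-1}\prod_{c\in s}K_c,$$ summed over all states, where $\alpha(s),\beta(s)$ are the numbers of $A$- and $B$-splittings and $\delta(s)$ is the number of state circles. Construction of $G_L^s$: glue a disc to each state circle of $s$ (vertex-discs); for each classical crossing glue a small planar band (edge-ribbon) connecting the two opposite arcs of the splitting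 at that crossing; sign the edge $+1$ if the crossing is $A$-split in $s$, $-1$ if $B$-split. Arrows: if the splitting respects the orientation of strands, put two arrows on the free edge arcs (the sides not attached to state circles) of the band, directed by the counterclockwise orientation of the plane; otherwise put two arrows on the attaching arcs of the band, directed by the counterclockwise orientation of the plane. For an arrow ribbon graph $G$ (surface decomposed into vertex-discs and edge-ribbons, with arrows tangent to the boundary arcs of these discs), the arrow dichromatic polynomial is $$A_G(a,\mathbf{b},c,\mathbf{K}):=\sum_{F\subseteq E(G)} a^{k(F)}\Big(\prod_{e\in F}b_e\Big)c^{bc(F)}\prod_{f\in\partial F}K_{i(f)},$$ summed over spanning subgraphs $F$, where $k(F)$ is the number of connected components of $F$, $bc(F)$ the number of boundary components of the ribbon subgraph $F$, the last product is over boundary components $f$ of $F$, and $i(f)$ is half the number of arrows on $f$ remaining after recursively cancelling neighbouring pairs pointing in the same direction along $f$ ($K_0=1$). *)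

theory Defs
  imports Complex_Main "HOL-Library.FuncSet" "HOL-Library.Numeral_Type" "HOL-Combinatorics.Cycles"
begin

section \<open>Arrows on closed curves\<close>

text \<open>
  The arrows met along an oriented arc are recorded as a list of booleans: \<^term>\<open>True\<close> for an
  arrow pointing along the direction of travel, \<^term>\<open>False\<close> for one pointing against it.
  A closed curve carries such a list up to rotation, hence the rule \<open>wrap\<close>.
\<close>

inductive cancel :: "bool list \<Rightarrow> bool list \<Rightarrow> bool" where
  adjacent: "cancel (u @ x # x # v) (u @ v)"
| wrap: "cancel (x # u @ [x]) u"

definition arrows_left :: "bool list \<Rightarrow> nat" where
  "arrows_left w = (THE n. \<exists>w'. cancel\<^sup>*\<^sup>* w w' \<and> (\<nexists>w''. cancel w' w'') \<and> n = length w')"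

fun alt_sum :: "bool list \<Rightarrow> int" where
  "alt_sum [] = 0"
| "alt_sum (x # w) = (if x then 1 else - 1) - alt_sum w"

lemma alt_sum_append: "alt_sum (u @ v) = alt_sum u + (- 1) ^ length u * alt_sum v"
  by (induction u) auto

lemma cancel_invariant:
  assumes "cancel w w'"
  shows "even (length w) = even (length w')"
    and "even (length w) \<Longrightarrow> \<bar>alt_sum w\<bar> = \<bar>alt_sum w'\<bar>"
  using assms by (cases; simp add: alt_sum_append)+

lemma cancel_rtrancl_invariant:
  assumes "cancel\<^sup>*\<^sup>* w w'"
  shows "even (length w) = even (length w') \<and>
    (even (length w) \<longrightarrow> \<bar>alt_sum w\<bar> = \<bar>alt_sum w'\<bar>)"
  using assms by induction (use cancel_invariant in auto)

lemma alt_sum_alternating: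
  "(\<nexists>u y v. x # w = u @ y # y # v) \<Longrightarrow>
    alt_sum (x # w) = (if x then 1 else - 1) * (1 + int (length w)) \<and>
    (last (x # w) = x \<longleftrightarrow> even (length w))"
proof (induction w arbitrary: x)
  case (Cons z w)
  have "z \<noteq> x"
  proof
    assume "z = x"
    then have "x # z # w = [] @ x # x # w" by simp
    then show False using Cons.prems by blast
  qed
  moreover have "\<nexists>u y v. z # w = u @ y # y # v" using Cons.prems by (metis append_Cons)
  ultimately show ?case using Cons.IH[of z] by auto
qed simp

lemma cancel_normal_form:
  assumes "\<nexists>w'. cancel w w'"
  shows "int (length w) = (if even (length w) then \<bar>alt_sum w\<bar> else 1)"
proof (cases w)
  case (Cons x v)
  have "\<nexists>u y v'. x # v = u @ y # y # v'" using assms Cons cancel.adjacent by metis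
  note alt = alt_sum_alternating[OF this]
  show ?thesis
  proof (cases "even (length w)")
    case True
    then show ?thesis using alt Cons by auto
  next
    case False
    then have "last w = x" using alt Cons by auto
    have "v = []"
    proof (rule ccontr)
      assume "v \<noteq> []"
      then have "w = x # butlast v @ [x]"
        using \<open>last w = x\<close> Cons by (cases v rule: rev_cases) simp_all
      then show False using assms cancel.wrap by metis
    qed
    then show ?thesis using Cons by simp
  qed
qed simp

lemma arrows_left_unique:
  "\<exists>!n. \<exists>w'. cancel\<^sup>*\<^sup>* w w' \<and> (\<nexists>w''. cancel w' w'') \<and> n = length w'"
proof (rule ex_ex1I)
  show "\<exists>n w'. cancel\<^sup>*\<^sup>* w w' \<and> (\<nexists>w''. cancel w' w'') \<and> n = length w'"
  proof (induction "length w" arbitrary: w rule: less_induct)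
    case less
    show ?case
    proof (cases "\<exists>v. cancel w v")
      case True
      then obtain v where v: "cancel w v" by blast
      then have "length v < length w" by cases auto
      from less[OF this] v show ?thesis by (meson converse_rtranclp_into_rtranclp)
    qed blast
  qed
next
  fix m n
  assume "\<exists>w'. cancel\<^sup>*\<^sup>* w w' \<and> (\<nexists>w''. cancel w' w'') \<and> m = length w'"
    and "\<exists>w'. cancel\<^sup>*\<^sup>* w w' \<and> (\<nexists>w''. cancel w' w'') \<and> n = length w'"
  then show "m = n"
    using cancel_rtrancl_invariant cancel_normal_form by (smt (verit) of_nat_eq_iff)
qed

lemma arrows_left_eq:
  "int (arrows_left w) = (if even (length w) then \<bar>alt_sum w\<bar> else 1)"
proof -
  obtain v where "cancel\<^sup>*\<^sup>* w v" "\<nexists>w''. cancel v w''" "arrows_left w = length v"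
    using theI'[OF arrows_left_unique[of w]] unfolding arrows_left_def by blast
  then show ?thesis using cancel_rtrancl_invariant cancel_normal_form by metis
qed

definition arrow_index :: "bool list \<Rightarrow> rat" where
  "arrow_index w = of_nat (arrows_left w) / 2"

definition arrow_var :: "(rat \<Rightarrow> 'a::one) \<Rightarrow> rat \<Rightarrow> 'a" where
  "arrow_var K i = (if i = 0 then 1 else K i)"

definition reverse_arrows :: "bool list \<Rightarrow> bool list" where
  "reverse_arrows w = map Not (rev w)"

definition orb :: "('p \<Rightarrow> 'p) set \<Rightarrow> 'p \<Rightarrow> 'p set" where
  "orb \<Phi> x = {y. (x, y) \<in> {(z, \<phi> z) | z \<phi>. \<phi> \<in> \<Phi>}\<^sup>*}"

definition orbs :: "('p \<Rightarrow> 'p) set \<Rightarrow> 'p set \<Rightarrow> 'p set set" where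
  "orbs \<Phi> X = orb \<Phi> ` X"

definition fpf_involution_on :: "'p set \<Rightarrow> ('p \<Rightarrow> 'p) \<Rightarrow> bool" where
  "fpf_involution_on X p \<longleftrightarrow> (\<forall>x\<in>X. p x \<in> X \<and> p x \<noteq> x \<and> p (p x) = x)"

text \<open>
  A family of closed curves cut into arcs at a finite set \<open>X\<close> of points, each point being an
  end of two arcs, is given by two fixed-point free involutions \<open>p\<close>, \<open>q\<close> of \<open>X\<close> taking a point
  to the other end of its first and of its second arc.  The curves are the members of
  \<open>orbs {p, q} X\<close>.  Here \<open>wp x\<close> lists the arrows on the \<open>p\<close>-arc at \<open>x\<close>, read from \<open>x\<close> to \<open>p x\<close>,
  and similarly \<open>wq\<close>.  Another starting point on the same curve rotates the list
  or reverses the direction of travel, neither of which affects \<^const>\<open>arrow_index\<close>.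
\<close>

definition curve_arrows ::
  "('p \<Rightarrow> 'p) \<Rightarrow> ('p \<Rightarrow> 'p) \<Rightarrow> ('p \<Rightarrow> bool list) \<Rightarrow> ('p \<Rightarrow> bool list) \<Rightarrow> 'p \<Rightarrow> bool list" where
  "curve_arrows p q wp wq x = concat (map (\<lambda>y. wp y @ wq (p y)) (support (q \<circ> p) x))"

definition curve_index ::
  "('p \<Rightarrow> 'p) \<Rightarrow> ('p \<Rightarrow> 'p) \<Rightarrow> ('p \<Rightarrow> bool list) \<Rightarrow> ('p \<Rightarrow> bool list) \<Rightarrow> 'p set \<Rightarrow> rat" where
  "curve_index p q wp wq C = arrow_index (curve_arrows p q wp wq (SOME x. x \<in> C))"


section \<open>Virtual link diagrams\<close>

text \<open>
  The four half-edges at a crossing \<open>c\<close> are \<open>(c, 0), (c, 1), (c, 2), (c, 3)\<close> in counterclockwise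
  order.  At a classical crossing the labelling is chosen such that \<open>0\<close> and \<open>2\<close> form the
  overcrossing strand.  The map \<open>adj\<close> takes a half-edge to the other half of its edge;
  \<open>outgoing\<close> tells whether the orientation of the link leaves the crossing along a half-edge.
  The set \<open>loops\<close> collects the link components that meet no crossing at all.
\<close>

type_synonym 'c half_edge = "'c \<times> 4"

record ('c, 'l) diagram =
  crossings :: "'c set"
  virtuals :: "'c set"
  adj :: "'c half_edge \<Rightarrow> 'c half_edge"
  outgoing :: "'c half_edge \<Rightarrow> bool"
  loops :: "'l set"

definition half_edges :: "('c, 'l) diagram \<Rightarrow> 'c half_edge set" where
  "half_edges D = crossings D \<times> UNIV"

definition classicals :: "('c, 'l) diagram \<Rightarrow> 'c set" where
  "classicals D = crossings D - virtuals D"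

definition rot :: "'c half_edge \<Rightarrow> 'c half_edge" where
  "rot x = (fst x, snd x + 1)"

text \<open>
  The last conjunct is planarity, that is Euler's formula summed over the connected components
  of the underlying 4-valent map: with \<open>V\<close> crossings there are \<open>2V\<close> edges, so that
  \<open>V - 2V + F = 2k\<close>.
\<close>

definition virtual_link_diagram :: "('c, 'l) diagram \<Rightarrow> bool" where
  "virtual_link_diagram D \<longleftrightarrow>
     finite (crossings D) \<and> finite (loops D) \<and> virtuals D \<subseteq> crossings D \<and>
     fpf_involution_on (half_edges D) (adj D) \<and>
     (\<forall>x\<in>half_edges D. outgoing D (adj D x) \<noteq> outgoing D x) \<and>
     (\<forall>c\<in>crossings D. \<forall>i. outgoing D (c, i + 2) \<noteq> outgoing D (c, i)) \<and>
     card (orbs {rot \<circ> adj D} (half_edges D)) =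
       card (crossings D) + 2 * card (orbs {rot, adj D} (half_edges D))"


section \<open>States and the arrow bracket\<close>

datatype splitting = A_split | B_split

fun other :: "splitting \<Rightarrow> splitting" where
  "other A_split = B_split"
| "other B_split = A_split"

text \<open>
  Rotated counterclockwise, the overcrossing strand sweeps the angles between \<open>0, 1\<close> and between
  \<open>2, 3\<close>.  Joining these two angles leaves one branch connecting \<open>1\<close> with \<open>2\<close> and another
  connecting \<open>3\<close> with \<open>0\<close>.
\<close>

fun branch :: "splitting \<Rightarrow> 4 \<Rightarrow> 4" where
  "branch A_split i = (if i \<in> {1, 3} then i + 1 else i - 1)"
| "branch B_split i = (if i \<in> {0, 2} then i + 1 else i - 1)"

text \<open>The single arrow directed counterclockwise about the crossing, read from \<open>i\<close> to \<open>branch t i\<close>.\<close>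

definition ccw_arrow :: "splitting \<Rightarrow> 4 \<Rightarrow> bool list" where
  "ccw_arrow t i = [branch t i = i + 1]"

definition respects_orientation :: "('c, 'l) diagram \<Rightarrow> 'c \<Rightarrow> splitting \<Rightarrow> bool" where
  "respects_orientation D c t \<longleftrightarrow> (\<forall>i. outgoing D (c, branch t i) \<noteq> outgoing D (c, i))"

definition states :: "('c, 'l) diagram \<Rightarrow> ('c \<Rightarrow> splitting) set" where
  "states D = classicals D \<rightarrow>\<^sub>E UNIV"

definition state_arc :: "('c, 'l) diagram \<Rightarrow> ('c \<Rightarrow> splitting) \<Rightarrow> 'c half_edge \<Rightarrow> 'c half_edge" where
  "state_arc D s x =
     (fst x, if fst x \<in> virtuals D then snd x + 2 else branch (s (fst x)) (snd x))"

definition state_arrows :: "('c, 'l) diagram \<Rightarrow> ('c \<Rightarrow> splitting) \<Rightarrow> 'c half_edge \<Rightarrow> bool list" where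
  "state_arrows D s x =
     (if fst x \<in> virtuals D \<or> respects_orientation D (fst x) (s (fst x)) then []
      else ccw_arrow (s (fst x)) (snd x))"

definition state_circles ::
  "('c, 'l) diagram \<Rightarrow> ('c \<Rightarrow> splitting) \<Rightarrow> ('c half_edge set + 'l) set" where
  "state_circles D s = orbs {state_arc D s, adj D} (half_edges D) <+> loops D"

definition circle_index ::
  "('c, 'l) diagram \<Rightarrow> ('c \<Rightarrow> splitting) \<Rightarrow> 'c half_edge set + 'l \<Rightarrow> rat" where
  "circle_index D s f =
     (case f of
        Inl C \<Rightarrow> curve_index (state_arc D s) (adj D) (state_arrows D s) (\<lambda>_. []) C
      | Inr l \<Rightarrow> arrow_index [])"

definition n_splits :: "('c, 'l) diagram \<Rightarrow> ('c \<Rightarrow> splitting) \<Rightarrow> splitting \<Rightarrow> nat" where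
  "n_splits D s t = card {c \<in> classicals D. s c = t}"

text \<open>
  The exponent \<open>\<delta>(s) - 1\<close> is an integer because it equals \<open>-1\<close> for the empty diagram.
\<close>

definition arrow_bracket ::
  "('c, 'l) diagram \<Rightarrow> 'a::field \<Rightarrow> 'a \<Rightarrow> 'a \<Rightarrow> (rat \<Rightarrow> 'a) \<Rightarrow> 'a" where
  "arrow_bracket D A B d K =
     (\<Sum>s\<in>states D. A ^ n_splits D s A_split * B ^ n_splits D s B_split *
        d powi (int (card (state_circles D s)) - 1) *
        (\<Prod>f\<in>state_circles D s. arrow_var K (circle_index D s f)))"


section \<open>Arrow ribbon graphs\<close>

text \<open>
  Each edge-ribbon is a rectangle with four corners.  At a corner three arcs end: an arc of the
  boundary of a vertex-disc lying between two ribbons, an attaching arc of a ribbon and a free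
  arc of the same ribbon; \<open>vertex_arc\<close>, \<open>attach_arc\<close> and \<open>free_arc\<close> take a corner to the other end
  of these arcs.  Orientability is not assumed.  Vertex-discs to which no ribbon is attached have
  no corners and form the set \<open>isolated\<close>.  The remaining fields list the arrows on the three kinds
  of arcs, read from the given corner to the other end, and on the boundaries of isolated
  vertex-discs, read from some starting point in some direction.
\<close>

record ('p, 'e, 'v) arrow_ribbon_graph =
  corners :: "'p set"
  ribbon :: "'p \<Rightarrow> 'e"
  vertex_arc :: "'p \<Rightarrow> 'p"
  attach_arc :: "'p \<Rightarrow> 'p"
  free_arc :: "'p \<Rightarrow> 'p"
  isolated :: "'v set"
  vertex_arrows :: "'p \<Rightarrow> bool list"
  attach_arrows :: "'p \<Rightarrow> bool list"
  free_arrows :: "'p \<Rightarrow> bool list"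
  isolated_arrows :: "'v \<Rightarrow> bool list"

definition is_arrow_ribbon_graph :: "('p, 'e, 'v, 'z) arrow_ribbon_graph_scheme \<Rightarrow> bool" where
  "is_arrow_ribbon_graph G \<longleftrightarrow>
     finite (corners G) \<and> finite (isolated G) \<and>
     fpf_involution_on (corners G) (vertex_arc G) \<and>
     fpf_involution_on (corners G) (attach_arc G) \<and>
     fpf_involution_on (corners G) (free_arc G) \<and>
     (\<forall>x\<in>corners G.
        attach_arc G x \<noteq> free_arc G x \<and>
        attach_arc G (free_arc G x) = free_arc G (attach_arc G x) \<and>
        {y \<in> corners G. ribbon G y = ribbon G x} =
          {x, attach_arc G x, free_arc G x, attach_arc G (free_arc G x)} \<and>
        vertex_arrows G (vertex_arc G x) = reverse_arrows (vertex_arrows G x) \<and>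
        attach_arrows G (attach_arc G x) = reverse_arrows (attach_arrows G x) \<and>
        free_arrows G (free_arc G x) = reverse_arrows (free_arrows G x))"

definition edges :: "('p, 'e, 'v, 'z) arrow_ribbon_graph_scheme \<Rightarrow> 'e set" where
  "edges G = ribbon G ` corners G"

text \<open>
  The corners of a vertex-disc are permuted transitively by \<^const>\<open>vertex_arc\<close> and
  \<^const>\<open>attach_arc\<close>; a ribbon in \<open>F\<close> joins in addition the two ends of its free arcs.
\<close>

definition n_components :: "('p, 'e, 'v, 'z) arrow_ribbon_graph_scheme \<Rightarrow> 'e set \<Rightarrow> nat" where
  "n_components G F =
     card (orbs {vertex_arc G, attach_arc G, \<lambda>x. if ribbon G x \<in> F then free_arc G x else x}
       (corners G)) + card (isolated G)"

text \<open>
  Where a ribbon is present the boundary runs along its free arcs; where it has been deleted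
  the boundary runs along its former attaching arcs.
\<close>

definition boundary_arc ::
  "('p, 'e, 'v, 'z) arrow_ribbon_graph_scheme \<Rightarrow> 'e set \<Rightarrow> 'p \<Rightarrow> 'p" where
  "boundary_arc G F x = (if ribbon G x \<in> F then free_arc G x else attach_arc G x)"

definition boundary_arrows ::
  "('p, 'e, 'v, 'z) arrow_ribbon_graph_scheme \<Rightarrow> 'e set \<Rightarrow> 'p \<Rightarrow> bool list" where
  "boundary_arrows G F x = (if ribbon G x \<in> F then free_arrows G x else attach_arrows G x)"

definition boundary ::
  "('p, 'e, 'v, 'z) arrow_ribbon_graph_scheme \<Rightarrow> 'e set \<Rightarrow> ('p set + 'v) set" where
  "boundary G F = orbs {vertex_arc G, boundary_arc G F} (corners G) <+> isolated G"

definition boundary_index ::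
  "('p, 'e, 'v, 'z) arrow_ribbon_graph_scheme \<Rightarrow> 'e set \<Rightarrow> 'p set + 'v \<Rightarrow> rat" where
  "boundary_index G F f =
     (case f of
        Inl C \<Rightarrow> curve_index (vertex_arc G) (boundary_arc G F)
                   (vertex_arrows G) (boundary_arrows G F) C
      | Inr v \<Rightarrow> arrow_index (isolated_arrows G v))"

definition arrow_dichromatic ::
  "('p, 'e, 'v, 'z) arrow_ribbon_graph_scheme \<Rightarrow>
     'a::field \<Rightarrow> ('e \<Rightarrow> 'a) \<Rightarrow> 'a \<Rightarrow> (rat \<Rightarrow> 'a) \<Rightarrow> 'a" where
  "arrow_dichromatic G a b c K =
     (\<Sum>F\<in>Pow (edges G). a ^ n_components G F * (\<Prod>e\<in>F. b e) * c ^ card (boundary G F) *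
        (\<Prod>f\<in>boundary G F. arrow_var K (boundary_index G F f)))"

record ('p, 'e, 'v) signed_arrow_ribbon_graph = "('p, 'e, 'v) arrow_ribbon_graph" +
  edge_sign :: "'e \<Rightarrow> int"

definition n_signed :: "('p, 'e, 'v, 'z) signed_arrow_ribbon_graph_scheme \<Rightarrow> int \<Rightarrow> nat" where
  "n_signed G \<epsilon> = card {e \<in> edges G. edge_sign G e = \<epsilon>}"


section \<open>The ribbon graph of a state\<close>

definition pass :: "('c, 'l) diagram \<Rightarrow> 'c half_edge \<Rightarrow> 'c half_edge" where
  "pass D x = (if fst x \<in> virtuals D then (fst x, snd x + 2) else x)"

text \<open>
  From a half-edge at a classical crossing, follow the strand straight through virtual crossings
  up to the next classical crossing.
\<close>

definition strand_end :: "('c, 'l) diagram \<Rightarrow> 'c half_edge \<Rightarrow> 'c half_edge" where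
  "strand_end D x =
     (let y = (\<lambda>n. adj D (((pass D \<circ> adj D) ^^ n) x))
      in y (LEAST n. fst (y n) \<in> classicals D))"

text \<open>The link components that meet virtual crossings only; they belong to every state.\<close>

definition virtual_circles :: "('c, 'l) diagram \<Rightarrow> 'c half_edge set set" where
  "virtual_circles D =
     {C \<in> orbs {pass D, adj D} (half_edges D). fst ` C \<subseteq> virtuals D}"

text \<open>
  The corners of the band at a classical crossing are its four half-edges.  The band is attached
  along the two branches of the splitting in \<open>s\<close>, and its free arcs run parallel to the two
  branches of the other splitting.  Directed counterclockwise, the arcs of the band lead
  from \<open>i\<close> to \<open>i + 1\<close>.
\<close>

definition state_graph ::
  "('c, 'l) diagram \<Rightarrow> ('c \<Rightarrow> splitting) \<Rightarrow>
     ('c half_edge, 'c, 'c half_edge set + 'l) signed_arrow_ribbon_graph" where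
  "state_graph D s =
     \<lparr> corners = classicals D \<times> UNIV,
       ribbon = fst,
       vertex_arc = strand_end D,
       attach_arc = (\<lambda>(c, i). (c, branch (s c) i)),
       free_arc = (\<lambda>(c, i). (c, branch (other (s c)) i)),
       isolated = virtual_circles D <+> loops D,
       vertex_arrows = (\<lambda>_. []),
       attach_arrows =
         (\<lambda>(c, i). if respects_orientation D c (s c) then [] else ccw_arrow (s c) i),
       free_arrows =
         (\<lambda>(c, i). if respects_orientation D c (s c) then ccw_arrow (other (s c)) i else []),
       isolated_arrows = (\<lambda>_. []),
       edge_sign = (\<lambda>c. if s c = A_split then 1 else - 1) \<rparr>"

lemma four_cases: "(i::4) = 0 \<or> i = 1 \<or> i = 2 \<or> i = 3"
proof (cases i)
  case (of_int z)
  then have "z = 0 \<or> z = 1 \<or> z = 2 \<or> z = 3" by auto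
  with of_int show ?thesis by auto
qed

lemma four_neq: "(i::4) + 2 \<noteq> i" "(i::4) + 1 \<noteq> i - 1"
  using four_cases[of i] by auto

lemma branch_simps:
  "branch t i \<noteq> i" "branch t (branch t i) = i"
  "branch t i \<noteq> branch (other t) i"
  "branch t (branch (other t) i) = i + 2"
  "branch (other t) (branch t i) = i + 2"
  "reverse_arrows (ccw_arrow t i) = ccw_arrow t (branch t i)"
  using four_cases[of i]
  by (cases t; auto simp: reverse_arrows_def ccw_arrow_def)+

lemma four_set: "UNIV = {i, branch t i, branch (other t) i, i + 2}"
proof -
  have "j \<in> {i, branch t i, branch (other t) i, i + 2}" for j
    using four_cases[of i] four_cases[of j] by (cases t; auto)
  then show ?thesis by auto
qed


lemma strand_end_involution:
  assumes D: "virtual_link_diagram D"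
  shows "fpf_involution_on (classicals D \<times> UNIV) (strand_end D)"
  unfolding fpf_involution_on_def
proof (intro ballI)
  let ?H = "half_edges D" and ?C = "classicals D"
  have adj: "adj D z \<in> ?H" "adj D z \<noteq> z" "adj D (adj D z) = z" if "z \<in> ?H" for z
    using D that by (auto simp: virtual_link_diagram_def fpf_involution_on_def)
  have pass: "pass D z \<in> ?H" "pass D (pass D z) = z" if "z \<in> ?H" for z
    using that four_cases[of "snd z"] by (auto simp: pass_def half_edges_def prod_eq_iff)
  have fin: "finite ?H"
    using D by (simp add: virtual_link_diagram_def half_edges_def)
  have virt: "fst z \<in> virtuals D" if "z \<in> ?H" "fst z \<notin> ?C" for z
    using that by (auto simp: half_edges_def classicals_def)
  fix x assume x: "x \<in> ?C \<times> (UNIV :: 4 set)"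
  then have xH: "x \<in> ?H" and xC: "fst x \<in> ?C" by (auto simp: half_edges_def classicals_def)
  define f where "f = pass D \<circ> adj D"
  define y where "y = (\<lambda>n. adj D ((f ^^ n) x))"
  define n where "n = (LEAST n. fst (y n) \<in> ?C)"
  have fH: "(f ^^ k) z \<in> ?H" if "z \<in> ?H" for k z
    by (induction k) (use that adj(1) pass(1) in \<open>auto simp: f_def\<close>)
  have yH: "y k \<in> ?H" for k
    by (simp add: y_def adj(1) fH xH)
  have adjy: "adj D (y k) = (f ^^ k) x" for k
    by (simp add: y_def adj(3) fH xH)
  have fSuc: "(f ^^ Suc k) x = pass D (y k)" for k
    by (simp add: f_def y_def)
  have "\<exists>k. fst (y k) \<in> ?C"
  proof (rule ccontr)
    assume no: "\<nexists>k. fst (y k) \<in> ?C"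
    have "inj_on f ?H"
      by (rule inj_on_inverseI[where g = "adj D \<circ> pass D"]) (simp add: f_def adj pass)
    have inj: "(f ^^ i) x \<noteq> (f ^^ (i + Suc m)) x" for i m
    proof (induction i)
      case 0
      have "fst ((f ^^ Suc m) x) \<in> virtuals D"
        unfolding fSuc using virt[OF yH] no by (auto simp: pass_def)
      then show ?case using xC by (auto simp: classicals_def simp del: funpow.simps)
    next
      case (Suc i)
      show ?case
      proof
        assume "(f ^^ Suc i) x = (f ^^ (Suc i + Suc m)) x"
        then have "f ((f ^^ i) x) = f ((f ^^ (i + Suc m)) x)" by simp
        then show False using Suc \<open>inj_on f ?H\<close> fH[OF xH] by (meson inj_onD)
      qed
    qed
    have "inj (\<lambda>i. (f ^^ i) x)"
    proof (rule linorder_injI)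
      fix i j :: nat assume "i < j"
      then show "(f ^^ i) x \<noteq> (f ^^ j) x"
        using inj[of i "j - Suc i"] by (simp del: funpow.simps)
    qed
    moreover have "range (\<lambda>i. (f ^^ i) x) \<subseteq> ?H" using fH[OF xH] by auto
    ultimately show False using fin by (meson finite_imageD finite_subset infinite_UNIV_nat)
  qed
  then have nC: "fst (y n) \<in> ?C" unfolding n_def by (meson LeastI_ex)
  have less: "fst (y k) \<notin> ?C" if "k < n" for k using that not_less_Least n_def by blast
  have send: "strand_end D x = y n"
    by (simp add: strand_end_def Let_def y_def n_def f_def)
  have rev_path: "(f ^^ k) (y n) = y (n - k)" if "k \<le> n" for k
    using that
  proof (induction k)
    case (Suc k)
    then have "(f ^^ Suc k) (y n) = f (y (Suc (n - Suc k)))"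
      by (simp add: Suc_diff_Suc)
    also have "\<dots> = pass D (adj D (y (Suc (n - Suc k))))"
      by (simp add: f_def)
    also have "\<dots> = y (n - Suc k)"
      unfolding adjy fSuc by (rule pass(2)[OF yH])
    finally show ?case .
  qed simp
  have "strand_end D (y n) = x"
  proof -
    have val: "adj D ((f ^^ k) (y n)) = (f ^^ (n - k)) x" if "k \<le> n" for k
      by (simp add: rev_path[OF that] adjy)
    have "(LEAST k. fst (adj D ((f ^^ k) (y n))) \<in> ?C) = n"
    proof (rule Least_equality)
      show "fst (adj D ((f ^^ n) (y n))) \<in> ?C" using val[of n] xC by simp
      fix k assume k: "fst (adj D ((f ^^ k) (y n))) \<in> ?C"
      show "n \<le> k"
      proof (rule ccontr)
        assume "\<not> n \<le> k"
        then have kn: "k < n" by simp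
        then have eq: "adj D ((f ^^ k) (y n)) = pass D (y (n - Suc k))"
          using val[of k] fSuc[of "n - Suc k"] by (simp add: Suc_diff_Suc del: funpow.simps)
        have "fst (y (n - Suc k)) \<in> virtuals D" using virt[OF yH] less kn by simp
        then show False using k unfolding eq by (simp add: pass_def classicals_def)
      qed
    qed
    then show ?thesis using val[of n]
      by (simp add: strand_end_def Let_def flip: f_def)
  qed
  moreover have "y n \<noteq> x"
  proof
    assume yx: "y n = x"
    show False
    proof (cases "even n")
      case True
      then obtain m where m: "n = 2 * m" by blast
      have "(f ^^ m) x = y m" using rev_path[of m] m yx by simp
      then show False using adj(2)[OF fH[OF xH], of m] by (simp add: y_def)
    next
      case False
      then obtain m where m: "n = 2 * m + 1" using oddE by blast
      have "pass D (y m) = y m" using rev_path[of "Suc m"] m yx fSuc[of m] by simp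
      moreover have "fst (y m) \<in> virtuals D" using virt[OF yH] less m by simp
      ultimately show False using four_neq(1) by (metis pass_def snd_conv)
    qed
  qed
  moreover have "y n \<in> ?C \<times> UNIV" using nC by (simp add: mem_Times_iff)
  ultimately show "strand_end D x \<in> ?C \<times> UNIV \<and> strand_end D x \<noteq> x \<and>
      strand_end D (strand_end D x) = x"
    by (simp add: send)
qed

lemma state_graph_is_arrow_ribbon_graph:
  assumes D: "virtual_link_diagram D"
  shows "is_arrow_ribbon_graph (state_graph D s)"
proof -
  have ribbon: "{y \<in> classicals D \<times> UNIV. fst y = c} =
      {(c, i), (c, branch t i), (c, branch (other t) i), (c, i + 2)}"
    if "c \<in> classicals D" for c t and i :: 4
  proof -
    have "{y \<in> classicals D \<times> UNIV. fst y = c} = Pair c ` (UNIV :: 4 set)"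
      using that by auto
    also have "\<dots> = Pair c ` {i, branch t i, branch (other t) i, i + 2}"
      by (rule arg_cong[OF four_set])
    finally show ?thesis by simp
  qed
  have "finite (crossings D)" and "finite (loops D)"
    using D by (auto simp: virtual_link_diagram_def)
  then have fin: "finite (virtual_circles D)" "finite (classicals D)" "finite (loops D)"
    by (simp_all add: virtual_circles_def orbs_def half_edges_def classicals_def)
  have inv: "fpf_involution_on (classicals D \<times> UNIV) (\<lambda>(c, i). (c, branch (t c) i))" for t
    by (auto simp: fpf_involution_on_def branch_simps simp del: branch.simps)
  have local: "\<forall>x\<in>corners G.
        attach_arc G x \<noteq> free_arc G x \<and>
        attach_arc G (free_arc G x) = free_arc G (attach_arc G x) \<and>
        {y \<in> corners G. ribbon G y = ribbon G x} =
          {x, attach_arc G x, free_arc G x, attach_arc G (free_arc G x)} \<and>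
        vertex_arrows G (vertex_arc G x) = reverse_arrows (vertex_arrows G x) \<and>
        attach_arrows G (attach_arc G x) = reverse_arrows (attach_arrows G x) \<and>
        free_arrows G (free_arc G x) = reverse_arrows (free_arrows G x)"
    if G: "G = state_graph D s" for G
  proof
    fix x assume "x \<in> corners G"
    then obtain c i where x: "x = (c, i)" and c: "c \<in> classicals D"
      by (auto simp: G state_graph_def)
    show "attach_arc G x \<noteq> free_arc G x \<and>
        attach_arc G (free_arc G x) = free_arc G (attach_arc G x) \<and>
        {y \<in> corners G. ribbon G y = ribbon G x} =
          {x, attach_arc G x, free_arc G x, attach_arc G (free_arc G x)} \<and>
        vertex_arrows G (vertex_arc G x) = reverse_arrows (vertex_arrows G x) \<and>
        attach_arrows G (attach_arc G x) = reverse_arrows (attach_arrows G x) \<and>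
        free_arrows G (free_arc G x) = reverse_arrows (free_arrows G x)"
      using ribbon[OF c, of i "s c"]
      by (simp add: G x state_graph_def branch_simps reverse_arrows_def[of "[]"])
  qed
  show ?thesis
    unfolding is_arrow_ribbon_graph_def
    by (intro conjI local[OF refl])
      (use strand_end_involution[OF D] fin inv in \<open>simp_all add: state_graph_def\<close>)
qed

end

theory Submission
  imports Defs
begin

text \<open>
  A spanning subgraph \<open>F\<close> of the ribbon graph of \<open>s\<close> corresponds to the state obtained from \<open>s\<close> by
  changing the splitting at the crossings in \<open>F\<close>; the weight \<open>b\<^sub>e\<close> accounts for one such change.
  The boundary of \<open>F\<close> runs along the strands and, at each crossing, parallel to the branches of
  that state.  Exactly one of the two splittings at a crossing respects the orientation, so the
  arrows agree as well.  A state circle is a cycle of half-edges, including those at virtual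
  crossings, whereas a boundary component only sees classical crossings: walking along the
  boundary component is the first return map of the walk along the circle.  Since virtual
  crossings carry no arrows, both walks read the same word, up to the starting point and
  the direction of travel, under which the index of a cyclic word is invariant.
\<close>

section \<open>Cyclic words of arrows\<close>

text \<open>By \<open>arrows_left_eq\<close> the parity of the length and, for even length, the
  absolute alternating sum determine the index. Invariance under a change of reading thus needs no
  analysis of cancellations.\<close>

lemma arrow_index_eqI:
  assumes "even (length v) = even (length w)"
    and "even (length w) \<Longrightarrow> \<bar>alt_sum v\<bar> = \<bar>alt_sum w\<bar>"
  shows "arrow_index v = arrow_index w"
proof -
  have "int (arrows_left v) = int (arrows_left w)"
    unfolding arrows_left_eq using assms by simp
  then show ?thesis by (simp add: arrow_index_def)
qed

text \<open>For even total length, \<open>u\<close> and \<open>v\<close> have equal parity: if both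
  are even the alternating sum is additive, and if both are odd the exchange only changes its
  sign.\<close>

lemma arrow_index_rotate: "arrow_index (u @ v) = arrow_index (v @ u)"
proof (rule arrow_index_eqI)
  assume "even (length (v @ u))"
  then have "even (length u) = even (length v)" by simp
  then show "\<bar>alt_sum (u @ v)\<bar> = \<bar>alt_sum (v @ u)\<bar>"
    by (cases "even (length v)") (simp_all add: alt_sum_append)
qed auto

lemma alt_sum_map_Not: "alt_sum (map Not w) = - alt_sum w"
  by (induction w) auto

text \<open>Reversal moves every letter to a position of the same parity in odd length and of the
  opposite parity in even length, so at most a global sign appears.\<close>

lemma abs_alt_sum_rev: "\<bar>alt_sum (rev w)\<bar> = \<bar>alt_sum w\<bar>"
proof -
  have "alt_sum (rev w) = (if even (length w) then - alt_sum w else alt_sum w)"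
    by (induction w) (auto simp: alt_sum_append)
  then show ?thesis by simp
qed

lemma arrow_index_reverse_arrows: "arrow_index (reverse_arrows w) = arrow_index w"
  by (rule arrow_index_eqI) (simp_all add: reverse_arrows_def alt_sum_map_Not abs_alt_sum_rev)

lemma reverse_arrows_concat:
  "reverse_arrows (concat ws) = concat (rev (map reverse_arrows ws))"
  by (induction ws) (simp_all add: reverse_arrows_def)


section \<open>Orbits and closed curves\<close>

lemma orb_refl: "x \<in> orb \<Phi> x"
  by (simp add: orb_def)

lemma orb_step: "y \<in> orb \<Phi> x \<Longrightarrow> \<phi> \<in> \<Phi> \<Longrightarrow> \<phi> y \<in> orb \<Phi> x"
  unfolding orb_def by (auto intro: rtrancl_into_rtrancl)

lemma orb_induct [consumes 1, case_names base step]: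
  assumes "y \<in> orb \<Phi> x" and "P x"
    and "\<And>z \<phi>. z \<in> orb \<Phi> x \<Longrightarrow> P z \<Longrightarrow> \<phi> \<in> \<Phi> \<Longrightarrow> P (\<phi> z)"
  shows "P y"
proof -
  have "(x, y) \<in> {(z, \<phi> z) | z \<phi>. \<phi> \<in> \<Phi>}\<^sup>*" using assms(1) by (simp add: orb_def)
  then show ?thesis
    by induction (use assms(2,3) in \<open>auto simp: orb_def\<close>)
qed

lemma orb_trans: "z \<in> orb \<Phi> y \<Longrightarrow> y \<in> orb \<Phi> x \<Longrightarrow> z \<in> orb \<Phi> x"
  unfolding orb_def by auto

lemma orb_cong:
  assumes "\<And>z. z \<in> orb {p, q} x \<Longrightarrow> p' z = p z"
  shows "orb {p', q} x = orb {p, q} x"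
proof
  have *: "y \<in> orb {p, q} x" if "y \<in> orb {p', q} x" for y
    using that by (induction rule: orb_induct) (auto simp: orb_refl assms intro: orb_step)
  then show "orb {p', q} x \<subseteq> orb {p, q} x" by blast
  have "y \<in> orb {p', q} x" if "y \<in> orb {p, q} x" for y
    using that
  proof (induction rule: orb_induct)
    case (step z \<phi>)
    then show ?case
      using orb_step[of z "{p', q}" x p'] orb_step[of z "{p', q}" x q] assms[of z] by auto
  qed (rule orb_refl)
  then show "orb {p, q} x \<subseteq> orb {p', q} x" by blast
qed

section \<open>Walking along a curve given by two involutions\<close>

locale closed_curves =
  fixes X :: "'p set" and p q :: "'p \<Rightarrow> 'p"
  assumes finite_points: "finite X"
    and involution_p: "fpf_involution_on X p"
    and involution_q: "fpf_involution_on X q"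
begin

text \<open>One \<open>step\<close> crosses two arcs, so the powers of \<open>step\<close> visit
  every other point of a curve in one direction of travel.\<close>

definition step :: "'p \<Rightarrow> 'p" where "step = q \<circ> p"

lemma step_apply: "step x = q (p x)"
  by (simp add: step_def)

lemma p_closed: "x \<in> X \<Longrightarrow> p x \<in> X" and p_p: "x \<in> X \<Longrightarrow> p (p x) = x"
  and q_closed: "x \<in> X \<Longrightarrow> q x \<in> X" and q_q: "x \<in> X \<Longrightarrow> q (q x) = x"
  using involution_p involution_q by (auto simp: fpf_involution_on_def)

lemma step_closed: "x \<in> X \<Longrightarrow> (step ^^ i) x \<in> X"
  by (induction i) (simp_all add: step_apply p_closed q_closed)

lemma inj_on_step_power: "inj_on (step ^^ i) X"
proof -
  have "bij_betw step X X"
    by (rule bij_betwI[where g = "p \<circ> q"]) (auto simp: step_apply p_closed q_closed p_p q_q)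
  then show ?thesis using bij_betw_funpow bij_betw_imp_inj_on by blast
qed

lemma step_returns:
  assumes "x \<in> X"
  shows "(step ^^ least_power step x) x = x" and "least_power step x > 0"
proof -
  have "range (\<lambda>i. (step ^^ i) x) \<subseteq> X" using step_closed[OF assms] by auto
  then have "finite (range (\<lambda>i. (step ^^ i) x))" using finite_points by (rule finite_subset)
  then have "\<not> inj (\<lambda>i. (step ^^ i) x)" using finite_imageD infinite_UNIV_nat by blast
  then obtain i j where "i < j" and ij: "(step ^^ i) x = (step ^^ j) x"
    using linorder_injI[of "\<lambda>i. (step ^^ i) x"] by metis
  then have "(step ^^ i) x = (step ^^ i) ((step ^^ (j - i)) x)"
    using funpow_add[of i "j - i" step] by simp
  \<comment> \<open>Injectivity of \<open>step ^^ i\<close> turns the repetition supplied by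
    finiteness into a return to \<open>x\<close> itself, which makes \<open>least_power\<close> a
    genuine period.\<close>
  then have "(step ^^ (j - i)) x = x"
    using inj_onD[OF inj_on_step_power _ assms step_closed[OF assms]] by metis
  then show "(step ^^ least_power step x) x = x" "least_power step x > 0"
    using least_powerI[of "j - i" step x] \<open>i < j\<close> by simp_all
qed

text \<open>Starting one step later moves the first entry of the support to its end, so the word is
  merely rotated.\<close>

lemma arrow_index_support_step:
  assumes x: "x \<in> X"
  shows "arrow_index (concat (map w (support step (step x)))) =
    arrow_index (concat (map w (support step x)))"
proof -
  have step_iff: "(step ^^ n) (step x) = step x \<longleftrightarrow> (step ^^ n) x = x" for n
    using inj_onD[OF inj_on_step_power[of 1], of "(step ^^ n) x" x] step_closed[OF x, of n] x
    by (auto simp: funpow_swap1[symmetric])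
  have eq: "least_power step (step x) = least_power step x"
    by (simp only: least_power_def step_iff)
  obtain m where m: "least_power step x = Suc m"
    using step_returns(2)[OF x] gr0_conv_Suc by blast
  let ?u = "map (\<lambda>i. (step ^^ Suc i) x) [0..<m]"
  have "support step x = x # ?u"
    unfolding m by (simp add: upt_conv_Cons map_Suc_upt[symmetric] del: upt_Suc funpow.simps(2))
  moreover have "support step (step x) = ?u @ [x]"
    using step_returns(1)[OF x] unfolding eq m by (simp add: funpow_swap1)
  ultimately show ?thesis
    using arrow_index_rotate[of "w x" "concat (map w ?u)"] by simp
qed

text \<open>The dihedral relation: \<open>q\<close> conjugates \<open>step\<close> to its
  inverse.\<close>

lemma step_q_step:
  assumes "x \<in> X"
  shows "(step ^^ i) (q ((step ^^ i) x)) = q x"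
proof (induction i)
  case (Suc i)
  have "(step ^^ Suc i) (q ((step ^^ Suc i) x)) = (step ^^ i) (step (q (step ((step ^^ i) x))))"
    by (simp add: funpow_swap1)
  also have "step (q (step ((step ^^ i) x))) = q ((step ^^ i) x)"
    using step_closed[OF assms, of i] by (simp add: step_apply p_closed q_closed p_p q_q)
  finally show ?case using Suc by simp
qed simp

text \<open>From \<open>q x\<close> the curve is traversed backwards: the same \<open>p\<close>-arcs
  occur in the opposite order, each entered at its other end.\<close>

lemma support_q:
  assumes x: "x \<in> X"
  shows "support step (q x) = rev (map p (support step x))"
proof -
  have returns: "(step ^^ n) (q y) = q y" if "y \<in> X" "(step ^^ n) y = y" for y n
    using step_q_step[OF that(1), of n] that(2) by simp
  have "(step ^^ n) (q x) = q x \<longleftrightarrow> (step ^^ n) x = x" for n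
    using returns[OF x] returns[OF q_closed[OF x]] q_q[OF x] by metis
  then have eq: "least_power step (q x) = least_power step x"
    by (simp only: least_power_def)
  let ?N = "least_power step x"
  have "(step ^^ i) (q x) = p ((step ^^ (?N - Suc i)) x)" if "i < ?N" for i
  proof -
    let ?z = "(step ^^ (?N - Suc i)) x"
    have "(step ^^ i) (step ?z) = (step ^^ (i + Suc (?N - Suc i))) x"
      by (simp only: funpow_add comp_apply funpow.simps(2))
    also have "\<dots> = x" using that step_returns(1)[OF x] by simp
    finally have "(step ^^ i) (q x) = q (step ?z)"
      using step_q_step[of "step ?z" i] step_closed[OF x, of "Suc (?N - Suc i)"] by simp
    then show ?thesis using step_closed[OF x, of "?N - Suc i"] by (simp add: step_apply p_closed q_q)
  qed
  then show ?thesis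
    unfolding eq by (intro nth_equalityI) (simp_all add: rev_nth)
qed

lemma arrow_index_support_q:
  assumes x: "x \<in> X" and w: "\<And>z. z \<in> X \<Longrightarrow> w (p z) = reverse_arrows (w z)"
  shows "arrow_index (concat (map w (support step (q x)))) =
    arrow_index (concat (map w (support step x)))"
proof -
  have "map w (support step (q x)) = rev (map reverse_arrows (map w (support step x)))"
    unfolding support_q[OF x] using w step_closed[OF x] by (simp add: rev_map)
  then show ?thesis
    by (simp only: reverse_arrows_concat[symmetric] arrow_index_reverse_arrows)
qed

lemma orb_closed: "x \<in> X \<Longrightarrow> y \<in> orb {p, q} x \<Longrightarrow> y \<in> X"
  by (erule orb_induct) (auto simp: p_closed q_closed)

text \<open>This makes the choice by \<open>SOME\<close> in \<open>curve_index\<close> harmless.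
  Moving the base point by \<open>q\<close> reverses the word; moving it by \<open>p\<close> amounts
  to a \<open>step\<close> followed by \<open>q\<close>.\<close>

lemma arrow_index_curve_arrows_orb:
  assumes x: "x \<in> X" and y: "y \<in> orb {p, q} x"
    and w: "\<And>z. z \<in> X \<Longrightarrow> w (p z) = reverse_arrows (w z)"
  shows "arrow_index (curve_arrows p q w (\<lambda>_. []) y) =
    arrow_index (curve_arrows p q w (\<lambda>_. []) x)"
proof -
  let ?i = "\<lambda>x. arrow_index (concat (map w (support step x)))"
  have "?i y = ?i x"
    using y
  proof (induction rule: orb_induct)
    case (step z \<phi>)
    have z: "z \<in> X" using orb_closed[OF x step.hyps(1)] .
    have q: "?i (q z) = ?i z" if "z \<in> X" for z
      using that w by (rule arrow_index_support_q)
    have "?i (p z) = ?i (q (p z))" using q[OF p_closed[OF z]] by simp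
    also have "\<dots> = ?i z" using arrow_index_support_step[OF z, of w] by (simp add: step_apply)
    finally show ?case using step.IH step.hyps(2) q[OF z] by auto
  qed simp
  then show ?thesis by (simp add: curve_arrows_def flip: step_def)
qed

lemma orb_eq:
  assumes x: "x \<in> X"
  shows "orb {p, q} x = range (\<lambda>i. (step ^^ i) x) \<union> range (\<lambda>i. p ((step ^^ i) x))"
    (is "_ = ?R")
proof
  have pow: "(step ^^ i) x \<in> orb {p, q} x" for i
    by (induction i) (auto simp: step_apply orb_refl intro: orb_step)
  then show "?R \<subseteq> orb {p, q} x" by (auto intro: orb_step)
  have "y \<in> ?R" if "y \<in> orb {p, q} x" for y
    using that
  proof (induction rule: orb_induct)
    case base
    show ?case by (auto intro: exI[of _ 0] simp: image_iff)
  next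
    case (step z \<phi>)
    have pR: "p ((step ^^ i) x) \<in> ?R" for i by blast
    have sR: "(step ^^ i) x \<in> ?R" for i by blast
    from step.IH consider i where "z = (step ^^ i) x" | i where "z = p ((step ^^ i) x)" by blast
    then show ?case
    proof cases
      case 1
      obtain m where m: "least_power step x = Suc m"
        using step_returns(2)[OF x] gr0_conv_Suc by blast
      \<comment> \<open>Adding a full period gives \<open>z\<close> a predecessor under
        \<open>step\<close> even when \<open>i\<close> is 0, so that \<open>q\<close> can undo the
        last arc.\<close>
      have "z = (step ^^ (i + Suc m)) x"
        using step_returns(1)[OF x] unfolding 1 m by (simp only: funpow_add comp_apply)
      then have "z = q (p ((step ^^ (i + m)) x))" by (simp add: step_apply)
      then have "q z = p ((step ^^ (i + m)) x)"
        using step_closed[OF x, of "i + m"] by (simp add: p_closed q_q)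
      then show ?thesis using step.hyps(2) 1 pR by fastforce
    next
      case 2
      have "p z = (step ^^ i) x" using 2 step_closed[OF x] p_p by simp
      moreover have "q z = (step ^^ Suc i) x" using 2 by (simp add: step_apply)
      ultimately show ?thesis using step.hyps(2) sR by (metis insertE singletonD)
    qed
  qed
  then show "orb {p, q} x \<subseteq> ?R" by blast
qed

lemma orb_sym:
  assumes x: "x \<in> X" and y: "y \<in> orb {p, q} x"
  shows "x \<in> orb {p, q} y"
  using y
proof (induction rule: orb_induct)
  case (step z \<phi>)
  have z: "z \<in> X" using orb_closed[OF x step.hyps(1)] .
  have "z \<in> orb {p, q} (\<phi> z)"
    using orb_step[OF orb_refl[of "\<phi> z"], of \<phi> "{p, q}"] step.hyps(2) z by (auto simp: p_p q_q)
  then show ?case using orb_trans step.IH by metis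
qed (rule orb_refl)

lemma orb_eq_orb:
  assumes "x \<in> X" and "y \<in> orb {p, q} x"
  shows "orb {p, q} y = orb {p, q} x"
  using orb_sym[OF assms] assms(2) orb_trans by (metis subsetI subset_antisym)

end

section \<open>First return maps\<close>

locale first_return =
  fixes S :: "'p set" and g h :: "'p \<Rightarrow> 'p" and r :: "'p \<Rightarrow> nat"
  assumes return_closed: "\<And>z. z \<in> S \<Longrightarrow> h z \<in> S"
    and return_eq: "\<And>z. z \<in> S \<Longrightarrow> h z = (g ^^ r z) z"
    and time_pos: "\<And>z. z \<in> S \<Longrightarrow> r z > 0"
    and before_return: "\<And>z i. z \<in> S \<Longrightarrow> 0 < i \<Longrightarrow> i < r z \<Longrightarrow> (g ^^ i) z \<notin> S"
begin

text \<open>The total number of \<open>g\<close>-steps spent on the first \<open>k\<close> returns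
  to \<open>S\<close> from \<open>x\<close>.\<close>

fun time :: "'p \<Rightarrow> nat \<Rightarrow> nat" where
  "time x 0 = 0"
| "time x (Suc k) = time x k + r ((h ^^ k) x)"

lemma power_closed: "x \<in> S \<Longrightarrow> (h ^^ k) x \<in> S"
  by (induction k) (simp_all add: return_closed)

lemma power_eq: "x \<in> S \<Longrightarrow> (h ^^ k) x = (g ^^ time x k) x"
proof (induction k)
  case (Suc k)
  then have "(h ^^ Suc k) x = (g ^^ r ((h ^^ k) x)) ((g ^^ time x k) x)"
    using return_eq[OF power_closed[OF Suc.prems, of k]] by simp
  also have "\<dots> = (g ^^ (r ((h ^^ k) x) + time x k)) x"
    by (simp only: funpow_add comp_apply)
  finally show ?case by (simp add: add.commute)
qed simp

lemma time_less: "x \<in> S \<Longrightarrow> time x k < time x (Suc k)"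
  using time_pos[OF power_closed] by simp

text \<open>A visit to \<open>S\<close> strictly between two consecutive return times would
  contradict \<open>before_return\<close>.\<close>

lemma time_of_visit:
  assumes x: "x \<in> S" and "(g ^^ i) x \<in> S" and "i < time x k"
  obtains j where "j < k" and "i = time x j"
proof -
  have "\<exists>j<k. i = time x j"
    using assms(3)
  proof (induction k)
    case (Suc k)
    show ?case
    proof (cases "i < time x k")
      case True
      then show ?thesis using Suc.IH less_SucI by blast
    next
      case False
      then have i: "i = (i - time x k) + time x k" by simp
      have "(g ^^ i) x = (g ^^ (i - time x k)) ((h ^^ k) x)"
        by (subst i) (simp only: funpow_add comp_apply power_eq[OF x])
      then have "\<not> 0 < i - time x k"
        using before_return[OF power_closed[OF x, of k], of "i - time x k"] assms(2) Suc.prems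
        by fastforce
      then show ?thesis using False by auto
    qed
  qed simp
  then show thesis using that by blast
qed

lemma power_visit:
  assumes x: "x \<in> S" and i: "(g ^^ i) x \<in> S"
  obtains j where "(g ^^ i) x = (h ^^ j) x"
proof -
  have "k \<le> time x k" for k
    by (induction k) (use time_less[OF x] in \<open>auto intro: Suc_leI le_less_trans simp del: time.simps(2)\<close>)
  then have "i < time x (Suc i)" by (meson Suc_le_lessD)
  then obtain j where "i = time x j" using time_of_visit[OF x i] by blast
  then show thesis using that power_eq[OF x] by metis
qed

text \<open>Outside \<open>S\<close> the \<open>g\<close>-walk reads only empty words, so deleting
  those points does not change the concatenation. The hypothesis that \<open>h\<close> returns makes
  its least period meaningful.\<close>

lemma concat_support:
  assumes x: "x \<in> S" and w: "\<And>i. (g ^^ i) x \<notin> S \<Longrightarrow> w ((g ^^ i) x) = []"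
    and returns: "(h ^^ n) x = x" "n > 0"
  shows "concat (map w (support g x)) = concat (map w (support h x))"
proof -
  have segment: "concat (map (\<lambda>i. w ((g ^^ i) x)) [0..<time x k]) =
      concat (map (\<lambda>i. w ((h ^^ i) x)) [0..<k])" for k
  proof (induction k)
    case (Suc k)
    let ?z = "(h ^^ k) x"
    have z: "?z \<in> S" using power_closed[OF x] .
    obtain m where m: "r ?z = Suc m" using time_pos[OF z] gr0_conv_Suc by blast
    have "w ((g ^^ i) x) = []" if "i \<in> {Suc (time x k)..<time x k + Suc m}" for i
    proof -
      have i: "i = (i - time x k) + time x k" using that by simp
      have "(g ^^ i) x = (g ^^ (i - time x k)) ?z"
        by (subst i) (simp only: funpow_add comp_apply power_eq[OF x])
      moreover have "(g ^^ (i - time x k)) ?z \<notin> S"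
        by (rule before_return[OF z]) (use that m in auto)
      ultimately show ?thesis using w[of i] by simp
    qed
    then have "concat (map (\<lambda>i. w ((g ^^ i) x)) [Suc (time x k)..<time x k + Suc m]) = []"
      by (simp add: concat_eq_Nil_conv del: upt_Suc)
    moreover have "[0..<time x (Suc k)] =
        [0..<time x k] @ time x k # [Suc (time x k)..<time x k + Suc m]"
      using m upt_add_eq_append[of 0 "time x k" "Suc m"]
        upt_conv_Cons[of "time x k" "time x k + Suc m"] by (simp del: upt_Suc)
    ultimately show ?case using Suc.IH by (simp add: power_eq[OF x])
  qed simp
  let ?k = "least_power h x"
  note k = least_powerI[OF returns]
  \<comment> \<open>Every return of \<open>g\<close> to \<open>x\<close> is a visit to
    \<open>S\<close>, hence occurs at some \<open>time x j\<close>, where \<open>h ^^ j\<close>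
    fixes \<open>x\<close>. So the least periods of the two walks correspond.\<close>
  have "least_power g x = time x ?k"
    unfolding least_power_def[of g]
  proof (rule Least_equality)
    have "time x 0 < time x ?k"
      using k(2) lift_Suc_mono_less[of "time x", OF time_less[OF x]] by blast
    then show "(g ^^ time x ?k) x = x \<and> 0 < time x ?k"
      using power_eq[OF x, of ?k] k(1) by simp
    fix i assume i: "(g ^^ i) x = x \<and> 0 < i"
    show "time x ?k \<le> i"
    proof (rule ccontr)
      assume "\<not> time x ?k \<le> i"
      then obtain j where j: "j < ?k" "i = time x j"
        using time_of_visit[OF x, of i ?k] i x by auto
      then have "(h ^^ j) x = x" "j > 0" using i power_eq[OF x] by (auto intro: gr0I)
      then show False using least_power_le[of j h x] j(1) by simp
    qed
  qed
  then show ?thesis using segment[of ?k] by (simp add: comp_def)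
qed

end


section \<open>State circles and boundary components\<close>

lemma other_other [simp]: "other (other u) = u"
  by (cases u) auto

lemma other_neq [simp]: "other u \<noteq> u" "u \<noteq> other u"
  by (cases u; simp)+

lemma neq_iff_other: "u \<noteq> v \<longleftrightarrow> u = other v"
  by (cases u; cases v) auto

locale diagram_state =
  fixes D :: "('c, 'l) diagram" and t :: "'c \<Rightarrow> splitting"
  assumes diagram: "virtual_link_diagram D"
begin

abbreviation S :: "'c half_edge set" where "S \<equiv> classicals D \<times> UNIV"

lemma S_subset: "S \<subseteq> half_edges D"
  by (auto simp: half_edges_def classicals_def)

lemma mem_S_iff: "x \<in> S \<longleftrightarrow> fst x \<in> classicals D"
  by (cases x) simp

lemma mem_S_iff_not_virtual: "x \<in> half_edges D \<Longrightarrow> x \<in> S \<longleftrightarrow> fst x \<notin> virtuals D"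
  by (auto simp: half_edges_def classicals_def)

lemma state_arc_involution:
  assumes "X = C \<times> UNIV"
  shows "fpf_involution_on X (state_arc D t)"
proof -
  have "i + 2 + 2 = i" for i :: 4 using four_cases[of i] by auto
  then show ?thesis
    using assms
    by (auto simp: fpf_involution_on_def state_arc_def branch_simps four_neq simp del: branch.simps)
qed

sublocale closed_curves "half_edges D" "state_arc D t" "adj D"
proof
  show "finite (half_edges D)" "fpf_involution_on (half_edges D) (adj D)"
    using diagram by (simp_all add: virtual_link_diagram_def half_edges_def)
  show "fpf_involution_on (half_edges D) (state_arc D t)"
    by (rule state_arc_involution) (rule half_edges_def)
qed

lemma state_arc_S: "state_arc D t x \<in> S \<longleftrightarrow> x \<in> S"
  by (simp add: mem_S_iff state_arc_def)

lemma strand_end_S: "x \<in> S \<Longrightarrow> strand_end D x \<in> S"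
  and strand_end_strand_end: "x \<in> S \<Longrightarrow> strand_end D (strand_end D x) = x"
  using strand_end_involution[OF diagram] unfolding fpf_involution_on_def by blast+

section \<open>The first return to the classical crossings\<close>

definition return_map :: "'c half_edge \<Rightarrow> 'c half_edge" where
  "return_map z = strand_end D (state_arc D t z)"

definition return_time :: "'c half_edge \<Rightarrow> nat" where
  "return_time z = (LEAST n. 0 < n \<and> (step ^^ n) z \<in> S)"

text \<open>At virtual crossings \<open>pass\<close> and \<open>state_arc\<close> coincide, so
  following the strand after the branch at \<open>z\<close> is the same as walking along the state
  circle until the next classical crossing.\<close>

lemma return_map_eq:
  assumes z: "z \<in> S"
  shows "0 < return_time z" and "return_map z = (step ^^ return_time z) z"
proof -
  define x where "x = state_arc D t z"
  define y where "y = (\<lambda>n. adj D (((pass D \<circ> adj D) ^^ n) x))"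
  define n where "n = (LEAST n. fst (y n) \<in> classicals D)"
  have send: "strand_end D x = y n"
    by (simp add: strand_end_def y_def n_def Let_def)
  have "x \<in> S" using z by (simp add: x_def state_arc_S)
  have yn: "y n \<in> S" using strand_end_S[OF \<open>x \<in> S\<close>] send by simp
  have less: "y k \<notin> S" if "k < n" for k
    using not_less_Least[OF that[unfolded n_def]] by (simp add: mem_S_iff)
  \<comment> \<open>The shift by one arises because \<open>y 0\<close> already lies one full step
    after \<open>z\<close>: the branch at \<open>z\<close> followed by \<open>adj\<close>.\<close>
  have y: "y k = (step ^^ Suc k) z" if "k \<le> n" for k
    using that
  proof (induction k)
    case 0
    then show ?case by (simp add: y_def x_def step_apply)
  next
    case (Suc k)
    have "y k \<in> half_edges D"
      using Suc step_closed[of z "Suc k"] z S_subset by auto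
    then have "fst (y k) \<in> virtuals D"
      using less[of k] Suc.prems mem_S_iff_not_virtual by auto
    then have "pass D (y k) = state_arc D t (y k)"
      by (simp add: pass_def state_arc_def)
    moreover have "y (Suc k) = adj D (pass D (y k))" by (simp add: y_def)
    ultimately show ?case using Suc by (simp add: step_apply)
  qed
  have "return_time z = Suc n"
    unfolding return_time_def
  proof (rule Least_equality)
    show "0 < Suc n \<and> (step ^^ Suc n) z \<in> S" using y[of n] yn by simp
    fix k assume k: "0 < k \<and> (step ^^ k) z \<in> S"
    show "Suc n \<le> k"
    proof (rule ccontr)
      assume "\<not> Suc n \<le> k"
      then have "k - 1 < n" "Suc (k - 1) = k" using k by auto
      then show False using y[of "k - 1"] less[of "k - 1"] k by simp
    qed
  qed
  then show "0 < return_time z" "return_map z = (step ^^ return_time z) z"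
    using y[of n] send by (simp_all add: x_def return_map_def)
qed

sublocale first_return S step return_map return_time
proof
  fix z assume z: "z \<in> S"
  show "return_map z \<in> S" using z by (simp add: return_map_def strand_end_S state_arc_S)
  show "return_map z = (step ^^ return_time z) z"
    using return_map_eq[OF z] by simp
  show "0 < return_time z" using return_map_eq[OF z] by simp
  show "(step ^^ i) z \<notin> S" if "0 < i" "i < return_time z" for i
    using not_less_Least[OF that(2)[unfolded return_time_def]] that(1) by simp
qed

lemma step_power_orb: "x \<in> half_edges D \<Longrightarrow> (step ^^ i) x \<in> orb {state_arc D t, adj D} x"
  by (simp add: orb_eq)

text \<open>A boundary component is the trace of a state circle on the classical half-edges: its two
  moves stay on the circle, and conversely every visit of the circle to \<open>S\<close> is a power
  of the return map, up to a final branch.\<close>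

lemma orb_boundary:
  assumes x: "x \<in> S" and b: "\<And>z. z \<in> S \<Longrightarrow> b z = state_arc D t z"
  shows "orb {strand_end D, b} x = orb {state_arc D t, adj D} x \<inter> S"
proof (intro equalityI subsetI)
  fix y assume "y \<in> orb {strand_end D, b} x"
  then show "y \<in> orb {state_arc D t, adj D} x \<inter> S"
  proof (induction rule: orb_induct)
    case (step z \<phi>)
    then have z: "z \<in> S" "z \<in> orb {state_arc D t, adj D} x" by auto
    have arc: "state_arc D t z \<in> orb {state_arc D t, adj D} x"
      using z(2) by (rule orb_step) simp
    have zH: "z \<in> half_edges D" using z(1) S_subset by blast
    \<comment> \<open>As \<open>state_arc\<close> is an involution, \<open>strand_end D z\<close> is
      the first return from \<open>state_arc D t z\<close>.\<close>
    have "strand_end D z = (step ^^ return_time (state_arc D t z)) (state_arc D t z)"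
      using return_map_eq(2)[of "state_arc D t z"] z(1) zH
      by (simp add: return_map_def state_arc_S p_p)
    then have "strand_end D z \<in> orb {state_arc D t, adj D} x"
      using orb_trans[OF step_power_orb arc] p_closed[OF zH] by simp
    then show ?case
      using step.hyps(2) z arc b by (auto simp: strand_end_S state_arc_S)
  qed (use x in \<open>simp add: orb_refl\<close>)
next
  fix y assume y: "y \<in> orb {state_arc D t, adj D} x \<inter> S"
  have visit: "(step ^^ i) x \<in> orb {strand_end D, b} x" if visit: "(step ^^ i) x \<in> S" for i
  proof -
    obtain j where j: "(step ^^ i) x = (return_map ^^ j) x"
      using power_visit[OF x visit] by blast
    have "(return_map ^^ j) x \<in> orb {strand_end D, b} x" for j
    proof (induction j)
      case (Suc j)
      let ?z = "(return_map ^^ j) x"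
      have "(return_map ^^ Suc j) x = strand_end D (b ?z)"
        using b[OF power_closed[OF x, of j]] by (simp add: return_map_def)
      then show ?case using Suc by (simp add: orb_step)
    qed (simp add: orb_refl)
    then show ?thesis using j by simp
  qed
  have "x \<in> half_edges D" using x S_subset by blast
  then consider i where "y = (step ^^ i) x" | i where "y = state_arc D t ((step ^^ i) x)"
    using y orb_eq by auto
  then show "y \<in> orb {strand_end D, b} x"
  proof cases
    case 1
    then show ?thesis using visit[of i] y by simp
  next
    case 2
    then have "(step ^^ i) x \<in> S" using y state_arc_S[of "(step ^^ i) x"] by simp
    then show ?thesis
      using visit[of i] orb_step[of "(step ^^ i) x" "{strand_end D, b}" x b] b 2 by simp
  qed
qed

text \<open>The base points differ because a boundary component is read starting with a vertex arc,
  which is free of arrows, whereas a state circle is read starting with a branch at a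
  crossing.\<close>

lemma curve_arrows_boundary:
  assumes x: "x \<in> S" and b: "\<And>z. z \<in> S \<Longrightarrow> b z = state_arc D t z"
    and v: "\<And>z. z \<in> S \<Longrightarrow> v z = w z"
    and w: "\<And>z. fst z \<in> virtuals D \<Longrightarrow> w z = []"
  shows "curve_arrows (strand_end D) b (\<lambda>_. []) v x =
    curve_arrows (state_arc D t) (adj D) w (\<lambda>_. []) (strand_end D x)"
proof -
  interpret B: closed_curves S "strand_end D" b
  proof
    show "finite S" using finite_points S_subset finite_subset by blast
    show "fpf_involution_on S b"
      using state_arc_involution[OF refl, of "classicals D"] b
      unfolding fpf_involution_on_def by metis
  qed (rule strand_end_involution[OF diagram])
  \<comment> \<open>Both walks alternate strands and branches, in opposite order;
    \<open>strand_end D\<close> intertwines them.\<close>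
  have pow: "(return_map ^^ i) (strand_end D x) = strand_end D ((B.step ^^ i) x)" for i
  proof (induction i)
    case (Suc i)
    let ?z = "strand_end D ((B.step ^^ i) x)"
    have "b ?z = state_arc D t ?z"
      using b strand_end_S[OF B.step_closed[OF x]] .
    then have "return_map ?z = strand_end D (B.step ((B.step ^^ i) x))"
      by (simp only: return_map_def B.step_apply)
    then show ?case using Suc by simp
  qed simp
  have "(return_map ^^ n) (strand_end D x) = strand_end D x \<longleftrightarrow> (B.step ^^ n) x = x" for n
    unfolding pow using strand_end_strand_end[OF x] strand_end_strand_end[OF B.step_closed[OF x]]
    by metis
  then have least: "least_power return_map (strand_end D x) = least_power B.step x"
    by (simp only: least_power_def)
  have "(return_map ^^ least_power B.step x) (strand_end D x) = strand_end D x"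
    unfolding pow using B.step_returns(1)[OF x] by simp
  moreover have "w ((step ^^ i) (strand_end D x)) = []"
    if "(step ^^ i) (strand_end D x) \<notin> S" for i
    using that w mem_S_iff_not_virtual[OF step_closed[OF subsetD[OF S_subset strand_end_S[OF x]]]]
    by simp
  ultimately have "concat (map w (support step (strand_end D x))) =
      concat (map w (support return_map (strand_end D x)))"
    using concat_support[OF strand_end_S[OF x], of w] B.step_returns(2)[OF x] by blast
  also have "\<dots> = concat (map (\<lambda>y. v (strand_end D y)) (support B.step x))"
    unfolding least using v strand_end_S[OF B.step_closed[OF x]] by (simp add: pow comp_def)
  finally show ?thesis
    unfolding curve_arrows_def step_def[symmetric] B.step_def[symmetric] by simp
qed

lemma circle_meeting_S:
  assumes "C \<in> orbs {state_arc D t, adj D} (half_edges D)" and "\<not> fst ` C \<subseteq> virtuals D"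
  obtains y where "y \<in> S" and "C = orb {state_arc D t, adj D} y"
proof -
  obtain x where x: "x \<in> half_edges D" "C = orb {state_arc D t, adj D} x"
    using assms(1) by (auto simp: orbs_def)
  obtain y where y: "y \<in> C" "fst y \<notin> virtuals D" using assms(2) by blast
  then have "y \<in> S" using orb_closed[OF x(1)] x(2) mem_S_iff_not_virtual by blast
  moreover have "C = orb {state_arc D t, adj D} y" using orb_eq_orb[OF x(1)] x(2) y(1) by blast
  ultimately show thesis using that by blast
qed

text \<open>If either orbit stays at virtual crossings, \<open>pass\<close> and
  \<open>state_arc\<close> agree along it, so the two orbits coincide. These circles are therefore
  common to all states.\<close>

lemma virtual_circles_eq:
  "virtual_circles D =
    {C \<in> orbs {state_arc D t, adj D} (half_edges D). fst ` C \<subseteq> virtuals D}"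
proof -
  have pass: "pass D z = state_arc D t z" if "fst z \<in> virtuals D" for z
    using that by (simp add: pass_def state_arc_def)
  have "orb {state_arc D t, adj D} x = orb {pass D, adj D} x"
    if "fst ` orb {pass D, adj D} x \<subseteq> virtuals D \<or>
      fst ` orb {state_arc D t, adj D} x \<subseteq> virtuals D" for x
    using that
  proof
    assume "fst ` orb {pass D, adj D} x \<subseteq> virtuals D"
    then show ?thesis by (intro orb_cong) (auto simp: pass)
  next
    assume "fst ` orb {state_arc D t, adj D} x \<subseteq> virtuals D"
    then show ?thesis by (intro orb_cong[symmetric]) (auto simp: pass)
  qed
  then show ?thesis unfolding virtual_circles_def orbs_def by blast
qed

section \<open>State circles correspond to boundary components\<close>

definition boundary_of_circle ::
  "'c half_edge set + 'l \<Rightarrow> 'c half_edge set + ('c half_edge set + 'l)" where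
  "boundary_of_circle f =
     (case f of
        Inl C \<Rightarrow> if fst ` C \<subseteq> virtuals D then Inr (Inl C) else Inl (C \<inter> S)
      | Inr l \<Rightarrow> Inr (Inr l))"

text \<open>A circle through a classical crossing is recovered from any point of its trace on
  \<open>S\<close>. The remaining circles have empty trace, and so are matched with isolated
  vertex-discs.\<close>

lemma bij_betw_boundary_of_circle:
  assumes b: "\<And>z. z \<in> S \<Longrightarrow> b z = state_arc D t z"
  shows "bij_betw boundary_of_circle (state_circles D t)
    (orbs {strand_end D, b} S <+> (virtual_circles D <+> loops D))"
  unfolding bij_betw_def
proof
  have eq: "C = C'"
    if C: "C \<in> orbs {state_arc D t, adj D} (half_edges D)" "\<not> fst ` C \<subseteq> virtuals D"
      and C': "C' \<in> orbs {state_arc D t, adj D} (half_edges D)" "\<not> fst ` C' \<subseteq> virtuals D"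
      and eq: "C \<inter> S = C' \<inter> S" for C C'
  proof -
    obtain y where y: "y \<in> S" "C = orb {state_arc D t, adj D} y"
      using circle_meeting_S[OF C] .
    obtain y' where y': "y' \<in> S" "C' = orb {state_arc D t, adj D} y'"
      using circle_meeting_S[OF C'] .
    have "y \<in> C \<inter> S" using y orb_refl by simp
    then have "y \<in> C'" using eq by simp
    then show ?thesis using orb_eq_orb[OF subsetD[OF S_subset y'(1)], of y] y(2) y'(2) by simp
  qed
  show "inj_on boundary_of_circle (state_circles D t)"
  proof (rule inj_onI)
    fix f f' assume f: "f \<in> state_circles D t" "f' \<in> state_circles D t"
      and "boundary_of_circle f = boundary_of_circle f'"
    then show "f = f'"
      using eq unfolding state_circles_def boundary_of_circle_def
      by (cases f; cases f'; simp only: sum.case split: if_splits; blast)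
  qed
  show "boundary_of_circle ` state_circles D t =
      orbs {strand_end D, b} S <+> (virtual_circles D <+> loops D)" (is "?L = ?R")
  proof (intro equalityI subsetI)
    fix f assume "f \<in> ?L"
    then obtain f' where f': "f' \<in> state_circles D t" "f = boundary_of_circle f'" by blast
    show "f \<in> ?R"
    proof (cases f')
      case (Inl C)
      then have C: "C \<in> orbs {state_arc D t, adj D} (half_edges D)"
        using f'(1) by (auto simp: state_circles_def)
      show ?thesis
      proof (cases "fst ` C \<subseteq> virtuals D")
        case True
        then show ?thesis using C Inl f'(2) by (auto simp: boundary_of_circle_def virtual_circles_eq)
      next
        case False
        obtain y where y: "y \<in> S" "C = orb {state_arc D t, adj D} y"
          using circle_meeting_S[OF C False] .
        have "orb {strand_end D, b} y = C \<inter> S"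
          unfolding y(2) by (rule orb_boundary[OF y(1)]) (rule b)
        then have "C \<inter> S \<in> orbs {strand_end D, b} S"
          unfolding orbs_def using y(1) by (metis image_eqI)
        then show ?thesis
          unfolding f'(2) Inl boundary_of_circle_def using False by (simp add: InlI)
      qed
    next
      case (Inr l)
      then show ?thesis using f' by (auto simp: state_circles_def boundary_of_circle_def)
    qed
  next
    fix f assume "f \<in> ?R"
    then consider x where "x \<in> S" "f = Inl (orb {strand_end D, b} x)"
      | C where "C \<in> virtual_circles D" "f = Inr (Inl C)"
      | l where "l \<in> loops D" "f = Inr (Inr l)"
      by (auto simp: orbs_def)
    then show "f \<in> ?L"
    proof cases
      case 1
      let ?C = "orb {state_arc D t, adj D} x"
      have "fst x \<notin> virtuals D" using 1(1) by (auto simp: classicals_def)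
      then have "\<not> fst ` ?C \<subseteq> virtuals D"
        using orb_refl[of x "{state_arc D t, adj D}"] by blast
      moreover have "orb {strand_end D, b} x = ?C \<inter> S"
        by (rule orb_boundary[OF 1(1)]) (rule b)
      ultimately have "f = boundary_of_circle (Inl ?C)"
        using 1(2) by (simp add: boundary_of_circle_def)
      moreover have "Inl ?C \<in> state_circles D t"
        unfolding state_circles_def orbs_def using subsetD[OF S_subset 1(1)] by blast
      ultimately show ?thesis by blast
    next
      case 2
      then have "f = boundary_of_circle (Inl C)" "Inl C \<in> state_circles D t"
        by (auto simp: boundary_of_circle_def virtual_circles_eq state_circles_def)
      then show ?thesis by blast
    next
      case 3
      then have "f = boundary_of_circle (Inr l)" "Inr l \<in> state_circles D t"
        by (auto simp: boundary_of_circle_def state_circles_def)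
      then show ?thesis by blast
    qed
  qed
qed

section \<open>Agreement of the arrow indices\<close>

lemma state_arrows_state_arc:
  "state_arrows D t (state_arc D t z) = reverse_arrows (state_arrows D t z)"
proof (cases "fst z \<in> virtuals D \<or> respects_orientation D (fst z) (t (fst z))")
  case False
  then show ?thesis by (simp add: state_arrows_def state_arc_def branch_simps)
qed (auto simp: state_arrows_def state_arc_def reverse_arrows_def)

lemma curve_index_virtual:
  assumes "C \<in> orbs {state_arc D t, adj D} (half_edges D)" and "fst ` C \<subseteq> virtuals D"
  shows "curve_index (state_arc D t) (adj D) (state_arrows D t) (\<lambda>_. []) C = arrow_index []"
proof -
  obtain x where x: "x \<in> half_edges D" "C = orb {state_arc D t, adj D} x"
    using assms(1) by (auto simp: orbs_def)
  define y where "y = (SOME y. y \<in> C)"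
  have yC: "y \<in> C" unfolding y_def using x(2) orb_refl by (metis someI)
  have "(step ^^ i) y \<in> C" for i
    using step_power_orb[of y i] orb_closed[OF x(1)] orb_eq_orb[OF x(1), of y] x(2) yC by blast
  then have "state_arrows D t ((step ^^ i) y) = []" for i
    using assms(2) by (auto simp: state_arrows_def)
  then have "curve_arrows (state_arc D t) (adj D) (state_arrows D t) (\<lambda>_. []) y = []"
    by (simp add: curve_arrows_def flip: step_def)
  then show ?thesis by (simp add: curve_index_def y_def)
qed

text \<open>The two sides choose unrelated base points. The word read from \<open>y\<close> on the
  boundary is the circle word from \<open>strand_end D y\<close>, and independence of the base point
  compares that with the choice \<open>z\<close> through \<open>x\<close>.\<close>

lemma curve_index_boundary:
  assumes x: "x \<in> S" and b: "\<And>z. z \<in> S \<Longrightarrow> b z = state_arc D t z"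
    and v: "\<And>z. z \<in> S \<Longrightarrow> v z = state_arrows D t z"
  shows "curve_index (strand_end D) b (\<lambda>_. []) v (orb {state_arc D t, adj D} x \<inter> S) =
    curve_index (state_arc D t) (adj D) (state_arrows D t) (\<lambda>_. [])
      (orb {state_arc D t, adj D} x)"
proof -
  let ?C = "orb {state_arc D t, adj D} x"
  let ?i = "\<lambda>y. arrow_index (curve_arrows (state_arc D t) (adj D) (state_arrows D t) (\<lambda>_. []) y)"
  have xH: "x \<in> half_edges D" using x S_subset by blast
  define y where "y = (SOME y. y \<in> ?C \<inter> S)"
  have y: "y \<in> ?C \<inter> S" unfolding y_def using x orb_refl by (metis IntI someI)
  define z where "z = (SOME z. z \<in> ?C)"
  have z: "z \<in> ?C" unfolding z_def using orb_refl by (metis someI)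
  have "strand_end D y \<in> orb {strand_end D, b} x"
    using y orb_boundary[OF x b] by (auto intro: orb_step)
  then have "strand_end D y \<in> ?C" using orb_boundary[OF x b] by blast
  moreover have "?i u = ?i x" if "u \<in> ?C" for u
    by (rule arrow_index_curve_arrows_orb[OF xH that]) (rule state_arrows_state_arc)
  ultimately have "?i (strand_end D y) = ?i x" and "?i z = ?i x" using z by blast+
  moreover have "curve_arrows (strand_end D) b (\<lambda>_. []) v y =
      curve_arrows (state_arc D t) (adj D) (state_arrows D t) (\<lambda>_. []) (strand_end D y)"
    by (rule curve_arrows_boundary) (use y b v in \<open>auto simp: state_arrows_def\<close>)
  ultimately show ?thesis
    unfolding curve_index_def y_def[symmetric] z_def[symmetric] by simp
qed

end


section \<open>The expansion over spanning subgraphs\<close>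

definition flip_on :: "'c set \<Rightarrow> ('c \<Rightarrow> splitting) \<Rightarrow> 'c \<Rightarrow> splitting" where
  "flip_on F s c = (if c \<in> F then other (s c) else s c)"

text \<open>As there are only two splittings, a state is determined by the set of crossings where it
  differs from \<open>s\<close>.\<close>

lemma bij_betw_flip_on:
  assumes s: "s \<in> states D"
  shows "bij_betw (\<lambda>F. flip_on F s) (Pow (classicals D)) (states D)"
proof (rule bij_betwI[where g = "\<lambda>t. {c \<in> classicals D. t c \<noteq> s c}"])
  show "(\<lambda>F. flip_on F s) \<in> Pow (classicals D) \<rightarrow> states D"
    using s by (auto simp: states_def flip_on_def PiE_def extensional_def)
  show "flip_on {c \<in> classicals D. t c \<noteq> s c} s = t" if "t \<in> states D" for t
  proof
    fix c show "flip_on {c \<in> classicals D. t c \<noteq> s c} s c = t c"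
      using s that by (cases "c \<in> classicals D")
        (auto simp: states_def flip_on_def PiE_def extensional_def neq_iff_other)
  qed
qed (auto simp: flip_on_def)

text \<open>The two splittings join a half-edge to its two neighbours. These are opposite to each
  other, so exactly one of them has the contrary direction. Hence the free arcs of a band carry
  arrows precisely when the flipped splitting violates the orientation.\<close>

lemma respects_orientation_other:
  assumes D: "virtual_link_diagram D" and c: "c \<in> crossings D"
  shows "respects_orientation D c (other u) \<longleftrightarrow> \<not> respects_orientation D c u"
proof -
  have opp: "outgoing D (c, i + 2) \<noteq> outgoing D (c, i)" for i
    using D c by (simp add: virtual_link_diagram_def)
  have all: "(\<forall>i::4. P i) \<longleftrightarrow> P 0 \<and> P 1 \<and> P 2 \<and> P 3" for P
    using four_cases by metis
  have four: "(- 1 :: 4) = 3" "(4 :: 4) = 0" by simp_all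
  show ?thesis
    using opp[of 0] opp[of 1] by (cases u) (auto simp: respects_orientation_def all four)
qed

lemma edges_state_graph: "edges (state_graph D s) = classicals D"
  by (auto simp: edges_def state_graph_def image_iff)

lemma boundary_arc_state_graph:
  assumes "x \<in> classicals D \<times> UNIV"
  shows "boundary_arc (state_graph D s) F x = state_arc D (flip_on F s) x"
  using assms
  by (auto simp: boundary_arc_def state_graph_def state_arc_def flip_on_def classicals_def
      simp del: branch.simps)

lemma boundary_arrows_state_graph:
  assumes D: "virtual_link_diagram D" and x: "x \<in> classicals D \<times> UNIV"
  shows "boundary_arrows (state_graph D s) F x = state_arrows D (flip_on F s) x"
  using x respects_orientation_other[OF D, of "fst x" "s (fst x)"]
  by (auto simp: boundary_arrows_def state_graph_def state_arrows_def flip_on_def classicals_def)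

lemma boundary_state_graph:
  assumes D: "virtual_link_diagram D"
  shows "card (boundary (state_graph D s) F) = card (state_circles D (flip_on F s))"
    and "(\<Prod>f\<in>boundary (state_graph D s) F.
        arrow_var K (boundary_index (state_graph D s) F f)) =
      (\<Prod>f\<in>state_circles D (flip_on F s). arrow_var K (circle_index D (flip_on F s) f))"
proof -
  let ?G = "state_graph D s" and ?t = "flip_on F s"
  interpret diagram_state D ?t by standard (rule D)
  note b = boundary_arc_state_graph[of _ D s F]
  have fields: "vertex_arc ?G = strand_end D" "vertex_arrows ?G = (\<lambda>_. [])" "corners ?G = S"
    "isolated ?G = virtual_circles D <+> loops D" "isolated_arrows ?G = (\<lambda>_. [])"
    by (simp_all add: state_graph_def)
  have bij: "bij_betw boundary_of_circle (state_circles D ?t) (boundary ?G F)"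
    unfolding boundary_def fields by (rule bij_betw_boundary_of_circle) (rule b)
  then show "card (boundary ?G F) = card (state_circles D ?t)"
    by (simp add: bij_betw_same_card)
  have "boundary_index ?G F (boundary_of_circle f) = circle_index D ?t f"
    if f: "f \<in> state_circles D ?t" for f
  proof (cases f)
    case (Inl C)
    then have C: "C \<in> orbs {state_arc D ?t, adj D} (half_edges D)"
      using f by (auto simp: state_circles_def)
    show ?thesis
    proof (cases "fst ` C \<subseteq> virtuals D")
      case True
      then show ?thesis
        using Inl curve_index_virtual[OF C]
        by (simp add: boundary_of_circle_def boundary_index_def circle_index_def fields)
    next
      case False
      then obtain x where "x \<in> S" "C = orb {state_arc D ?t, adj D} x"
        using circle_meeting_S[OF C] by blast
      then show ?thesis
        using Inl False curve_index_boundary[OF _ b boundary_arrows_state_graph[OF D]]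
        by (simp add: boundary_of_circle_def boundary_index_def circle_index_def fields)
    qed
  next
    case (Inr l)
    then show ?thesis
      by (simp add: boundary_of_circle_def boundary_index_def circle_index_def fields)
  qed
  then show "(\<Prod>f\<in>boundary ?G F. arrow_var K (boundary_index ?G F f)) =
      (\<Prod>f\<in>state_circles D ?t. arrow_var K (circle_index D ?t f))"
    by (simp add: prod.reindex_bij_betw[OF bij, symmetric])
qed

text \<open>Writing the weight of a state as a product over crossings allows the effect of a flip to
  be checked at one crossing at a time.\<close>

lemma power_card_splits:
  fixes A B :: "'a::comm_monoid_mult"
  assumes "finite X"
  shows "A ^ card {c \<in> X. t c = A_split} * B ^ card {c \<in> X. t c = B_split} =
    (\<Prod>c\<in>X. if t c = A_split then A else B)"
proof -
  have "t c = B_split \<longleftrightarrow> t c \<noteq> A_split" for c by (cases "t c") simp_all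
  then have "{c \<in> X. t c = B_split} = X \<inter> - {c. t c = A_split}" by auto
  then show ?thesis
    using assms by (simp add: prod.If_cases Int_def)
qed

theorem mainTheorem4:
  fixes D :: "('c, 'l) diagram" and s :: "'c \<Rightarrow> splitting"
    and A B d :: "'a::field" and K :: "rat \<Rightarrow> 'a"
  assumes "virtual_link_diagram D" and "s \<in> states D"
    and "A \<noteq> 0" and "B \<noteq> 0" and "d \<noteq> 0"
  shows "arrow_bracket D A B d K =
    A ^ n_signed (state_graph D s) 1 * B ^ n_signed (state_graph D s) (- 1) / d *
    arrow_dichromatic (state_graph D s) 1
      (\<lambda>e. if edge_sign (state_graph D s) e = 1 then B / A else A / B) d K"
proof -
  let ?G = "state_graph D s" and ?X = "classicals D"
  let ?b = "\<lambda>e. if edge_sign ?G e = 1 then B / A else A / B"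
  let ?P = "\<lambda>t. \<Prod>f\<in>state_circles D t. arrow_var K (circle_index D t f)"
  have fin: "finite ?X"
    using assms(1) by (simp add: virtual_link_diagram_def classicals_def)
  have sign: "edge_sign ?G c = (if s c = A_split then 1 else - 1)" for c
    by (simp add: state_graph_def)
  have signed: "n_signed ?G 1 = card {c \<in> ?X. s c = A_split}"
    "n_signed ?G (- 1) = card {c \<in> ?X. s c = B_split}"
    unfolding n_signed_def edges_state_graph sign
    by (auto intro!: arg_cong[where f = card]) (metis splitting.exhaust)+
  have weight: "A ^ n_splits D (flip_on F s) A_split * B ^ n_splits D (flip_on F s) B_split =
      A ^ n_signed ?G 1 * B ^ n_signed ?G (- 1) * prod ?b F" if "F \<subseteq> ?X" for F
  proof -
    \<comment> \<open>Crossings outside \<open>F\<close> contribute the factor 1, so both products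
      run over all classical crossings.\<close>
    have "prod ?b F = (\<Prod>c\<in>?X. if c \<in> F then ?b c else 1)"
      using that fin by (simp add: prod.If_cases Int_absorb1)
    then have "A ^ n_signed ?G 1 * B ^ n_signed ?G (- 1) * prod ?b F =
        (\<Prod>c\<in>?X. (if s c = A_split then A else B) * (if c \<in> F then ?b c else 1))"
      unfolding signed power_card_splits[OF fin] by (simp add: prod.distrib)
    also have "\<dots> = (\<Prod>c\<in>?X. if flip_on F s c = A_split then A else B)"
    proof (rule prod.cong[OF refl])
      fix c
      show "(if s c = A_split then A else B) * (if c \<in> F then ?b c else 1) =
          (if flip_on F s c = A_split then A else B)"
        using assms(3,4) by (cases "s c") (simp_all add: sign flip_on_def)
    qed
    finally show ?thesis
      unfolding n_splits_def power_card_splits[OF fin] by simp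
  qed
  have "arrow_bracket D A B d K =
      (\<Sum>F\<in>Pow ?X. A ^ n_splits D (flip_on F s) A_split * B ^ n_splits D (flip_on F s) B_split *
        d powi (int (card (state_circles D (flip_on F s))) - 1) * ?P (flip_on F s))"
    unfolding arrow_bracket_def
    by (rule sum.reindex_bij_betw[OF bij_betw_flip_on[OF assms(2)], symmetric])
  also have "\<dots> = (\<Sum>F\<in>Pow ?X. A ^ n_signed ?G 1 * B ^ n_signed ?G (- 1) / d *
      (1 ^ n_components ?G F * prod ?b F * d ^ card (boundary ?G F) *
        (\<Prod>f\<in>boundary ?G F. arrow_var K (boundary_index ?G F f))))"
    \<comment> \<open>Since \<open>d\<close> is nonzero, the integer power with exponent one less
      than the number of circles is \<open>d ^ card (boundary ?G F) / d\<close>, also when there are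
      no circles at all.\<close>
    using assms(5)
    by (intro sum.cong refl)
      (simp add: weight boundary_state_graph[OF assms(1)] power_int_diff)
  also have "\<dots> = A ^ n_signed ?G 1 * B ^ n_signed ?G (- 1) / d * arrow_dichromatic ?G 1 ?b d K"
    unfolding arrow_dichromatic_def edges_state_graph sum_distrib_left ..
  finally show ?thesis .
qed

end
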